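(* Consider an $M$-dimensional quantum system with $n$ measurements, with unitary matrices $U_0,\dots,U_{n-1}$, initial probability mass function $p(x_0)$ and measurement factors $f_1,\dots,f_n$, and let $\rho_k$ and $\tilde\rho_k$ be the (normalized) pre- and post-measurement density matrices, all as defined in the context. Let $1\le k\le n-1$ and let $y_1\in\mathcal{Y}_1,\dots,y_k\in\mathcal{Y}_k$ be outcomes for which $\tilde\rho_k$ and $\rho_{k+1}$ are defined (i.e., $\operatorname{tr}(D_k)\ne0$ and $\operatorname{tr}(C_{k+1})\neq 0$). Then $$\rho_{k+1}=U_k\,\tilde\rho_k\,U_k^{\mathsf H}.$$
   Context: A matrix $A\in\mathbb{C}^{M\times M}$ is viewed as a function $(x,y)\mapsto A(x,y)$, with row index $x$ and column index $y$. $A^{\mathsf H}$ is the Hermitian transpose, $\overline{\,\cdot\,}$ is complex conjugation, and $I$ is the identity matrix. System. Let $M,n\ge1$ be integers, $p(x_0)$ a probability mass function on $\{1,\dots,M\}$, $U_0,\dots,U_{n-1}\in\mathbb{C}^{M\times M}$ unitary matrices, and for $k=1,\dots,n$ let $f_k(x_k,x_k',\tilde x_k,\tilde x_k',y_k)$ be a measurement factor with $x_k,x_k',\tilde x_k,\tilde x_k'\in\{1,\dots,M\}$ and $y_k$ in a finite set $\mathcal{Y}_k$, of one of two types. (i) Basic projection type: $\mathcal{Y}_k=\{1,\dots,M\}$, and for some unitary $B_k\in\mathbb{C}^{M\times M}$, $$f_k(x_k,x_k',\tilde x_k,\tilde x_k',y)=B_k(\tilde x_k,y)\,\overline{B_k(x_k,y)}\;B_k(x_k',y)\,\overline{B_k(\tilde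 x_k',y)}.$$ (ii) General type: there are matrices $A_k(y)\in\mathbb{C}^{M\times M}$, $y\in\mathcal{Y}_k$, with $\sum_{y\in\mathcal{Y}_k}A_k(y)^{\mathsf H}A_k(y)=I$, such that $$f_k(x_k,x_k',\tilde x_k,\tilde x_k',y)=A_k(y)(\tilde x_k,x_k)\;\overline{A_k(y)(\tilde x_k',x_k')}.$$ Density matrices. For fixed outcomes $y_1,y_2,\dots$, define the $M\times M$ matrices $$C_k(x_k,x_k')=\sum p(x_0)\,U_0(x_1,x_0)\overline{U_0(x_1',x_0)}\prod_{j=1}^{k-1}\Big[f_j(x_j,x_j',\tilde x_j,\tilde x_j',y_j)\,U_j(x_{j+1},\tilde x_j)\,\overline{U_j(x_{j+1}',\tilde x_j')}\Big],$$ where the sum is over $x_0$ and all $x_j,x_j',\tilde x_j,\tilde x_j'$ with $1\le j\le k-1$, each ranging over $\{1,\dots,M\}$, and $$D_k(\tilde x_k,\tilde x_k')=\sum p(x_0)\,U_0(x_1,x_0)\overline{U_0(x_1',x_0)}\prod_{j=1}^{k-1}\Big[f_j(x_j,x_j',\tilde x_j,\tilde x_j',y_j)\,U_j(x_{j+1},\tilde x_j)\,\overline{U_j(x_{j+1}',\tilde x_j')}\Big]f_k(x_k,x_k',\tilde x_k,\tilde x_k',y_k),$$ where the sum is over $x_0$, all $x_j,x_j',\tilde x_j,\tilde x_j'$ with $1\le j\le k-1$, and $x_k,x_k'$. When the traces are nonzero, the density matrix before the $k$-th measurement (given $y_1,\dots,y_{k-1}$) is $\rho_k=C_k/\operatorname{tr}(C_k)$,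 and the density matrix after observing $Y_k=y_k$ (given $y_1,\dots,y_k$) is $\tilde\rho_k=D_k/\operatorname{tr}(D_k)$. *)

theory Defs
  imports "HOL-Analysis.Analysis" "HOL-Probability.Probability_Mass_Function"
begin

text \<open>
  The index set \<open>{1..M}\<close> is a type \<open>'m\<close> of class \<^class>\<open>finite\<close> with \<open>CARD('m) = M\<close>, and the
  entry \<open>A(x, y)\<close> is \<open>A $ x $ y\<close>.
\<close>

definition hermitian_transpose :: "complex ^ 'm ^ 'n \<Rightarrow> complex ^ 'n ^ 'm" where
  "hermitian_transpose A = (\<chi> i j. cnj (A $ j $ i))"

definition unitary_matrix :: "complex ^ 'm ^ 'm \<Rightarrow> bool" where
  "unitary_matrix A \<longleftrightarrow>
     hermitian_transpose A ** A = mat 1 \<and> A ** hermitian_transpose A = mat 1"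

text \<open>
  A factor \<open>f\<close> takes its arguments in the order \<open>x, x', xt, xt', y\<close>, where \<open>xt\<close> stands for
  \<open>x\<close> with a tilde. The alphabets of the different measurements are subsets of one outcome type.
  This type is the sum \<open>'m + 'y\<close>, so that the alphabet \<open>{1..M}\<close> of a basic projection can be
  taken literally, as the image of \<open>'m\<close>, next to arbitrary finite alphabets of general measurements.
\<close>

type_synonym ('m, 'o) factor = "'m \<Rightarrow> 'm \<Rightarrow> 'm \<Rightarrow> 'm \<Rightarrow> 'o \<Rightarrow> complex"

definition basic_projection_factor ::
    "('m::finite + 'y) set \<Rightarrow> ('m, 'm + 'y) factor \<Rightarrow> bool" where
  "basic_projection_factor Y f \<longleftrightarrow>
     Y = range Inl \<and>
     (\<exists>B :: complex ^ 'm ^ 'm. unitary_matrix B \<and>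
        (\<forall>x x' xt xt' y. f x x' xt xt' (Inl y) =
           B $ xt $ y * cnj (B $ x $ y) * (B $ x' $ y) * cnj (B $ xt' $ y)))"

definition general_factor :: "'o set \<Rightarrow> ('m::finite, 'o) factor \<Rightarrow> bool" where
  "general_factor Y f \<longleftrightarrow>
     finite Y \<and>
     (\<exists>A :: 'o \<Rightarrow> complex ^ 'm ^ 'm.
        (\<Sum>y\<in>Y. hermitian_transpose (A y) ** A y) = mat 1 \<and>
        (\<forall>x x' xt xt'. \<forall>y\<in>Y. f x x' xt xt' y = A y $ xt $ x * cnj (A y $ xt' $ x')))"

definition measurement_factor ::
    "('m::finite + 'y) set \<Rightarrow> ('m, 'm + 'y) factor \<Rightarrow> bool" where
  "measurement_factor Y f \<longleftrightarrow> basic_projection_factor Y f \<or> general_factor Y f"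

text \<open>
  The common summand of \<open>C\<^sub>k\<close> and \<open>D\<^sub>k\<close>. The variables \<open>x\<^sub>j\<close> with \<open>j \<ge> 1\<close> are the values of a
  function \<open>x\<close>, and likewise for \<open>x'\<close>, \<open>xt\<close>, \<open>xt'\<close>; the variable \<open>x\<^sub>0\<close> is separate, because it
  is shared by the primed and the unprimed path.
\<close>

definition path_weight ::
    "'m::finite pmf \<Rightarrow> (nat \<Rightarrow> complex ^ 'm ^ 'm) \<Rightarrow> (nat \<Rightarrow> ('m, 'o) factor) \<Rightarrow> (nat \<Rightarrow> 'o) \<Rightarrow>
     nat \<Rightarrow> 'm \<Rightarrow> (nat \<Rightarrow> 'm) \<Rightarrow> (nat \<Rightarrow> 'm) \<Rightarrow> (nat \<Rightarrow> 'm) \<Rightarrow> (nat \<Rightarrow> 'm) \<Rightarrow> complex" where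
  "path_weight p U f y k x0 x x' xt xt' =
     of_real (pmf p x0) * (U 0 $ x 1 $ x0) * cnj (U 0 $ x' 1 $ x0) *
     (\<Prod>j\<in>{1..<k}. f j (x j) (x' j) (xt j) (xt' j) (y j) *
        (U j $ x (j + 1) $ xt j) * cnj (U j $ x' (j + 1) $ xt' j))"

definition paths :: "nat set \<Rightarrow> (nat \<Rightarrow> 'm) set" where
  "paths J = J \<rightarrow>\<^sub>E UNIV"

definition paths_to :: "nat \<Rightarrow> 'm \<Rightarrow> (nat \<Rightarrow> 'm) set" where
  "paths_to k a = {x \<in> paths {1..k}. x k = a}"

definition pre_matrix ::
    "'m::finite pmf \<Rightarrow> (nat \<Rightarrow> complex ^ 'm ^ 'm) \<Rightarrow> (nat \<Rightarrow> ('m, 'o) factor) \<Rightarrow> (nat \<Rightarrow> 'o) \<Rightarrow>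
     nat \<Rightarrow> complex ^ 'm ^ 'm" where
  "pre_matrix p U f y k = (\<chi> a a'.
     \<Sum>x0\<in>UNIV. \<Sum>x\<in>paths_to k a. \<Sum>x'\<in>paths_to k a'.
     \<Sum>xt\<in>paths {1..<k}. \<Sum>xt'\<in>paths {1..<k}.
       path_weight p U f y k x0 x x' xt xt')"

definition post_matrix ::
    "'m::finite pmf \<Rightarrow> (nat \<Rightarrow> complex ^ 'm ^ 'm) \<Rightarrow> (nat \<Rightarrow> ('m, 'o) factor) \<Rightarrow> (nat \<Rightarrow> 'o) \<Rightarrow>
     nat \<Rightarrow> complex ^ 'm ^ 'm" where
  "post_matrix p U f y k = (\<chi> a a'.
     \<Sum>x0\<in>UNIV. \<Sum>x\<in>paths {1..k}. \<Sum>x'\<in>paths {1..k}.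
     \<Sum>xt\<in>paths_to k a. \<Sum>xt'\<in>paths_to k a'.
       path_weight p U f y k x0 x x' xt xt' * f k (x k) (x' k) (xt k) (xt' k) (y k))"

text \<open>
  Only meaningful when the trace is nonzero.
\<close>

definition normalize_trace :: "complex ^ 'm ^ 'm \<Rightarrow> complex ^ 'm ^ 'm" where
  "normalize_trace A = (\<chi> a a'. A $ a $ a' / trace A)"

definition pre_density ::
    "'m::finite pmf \<Rightarrow> (nat \<Rightarrow> complex ^ 'm ^ 'm) \<Rightarrow> (nat \<Rightarrow> ('m, 'o) factor) \<Rightarrow> (nat \<Rightarrow> 'o) \<Rightarrow>
     nat \<Rightarrow> complex ^ 'm ^ 'm" where
  "pre_density p U f y k = normalize_trace (pre_matrix p U f y k)"

definition post_density ::
    "'m::finite pmf \<Rightarrow> (nat \<Rightarrow> complex ^ 'm ^ 'm) \<Rightarrow> (nat \<Rightarrow> ('m, 'o) factor) \<Rightarrow> (nat \<Rightarrow> 'o) \<Rightarrow>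
     nat \<Rightarrow> complex ^ 'm ^ 'm" where
  "post_density p U f y k = normalize_trace (post_matrix p U f y k)"

end

theory Submission
  imports Defs
begin

text \<open>The unnormalized matrices already satisfy \<open>C_{k+1} = U_k D_k U_k^H\<close>
  (\<open>pre_matrix_Suc\<close>). The summand of \<open>C_{k+1}\<close> is that of
  \<open>D_k\<close> times \<open>U_k(a, xt_k)\<close> and the conjugate of
  \<open>U_k(a', xt'_k)\<close> (\<open>path_weight_extend\<close>). These two entries see only the
  endpoints of the tilde paths, so grouping those paths by endpoint
  (\<open>sum_path_pairs_by_endpoints\<close>) turns the path sum into a matrix product. Conjugation
  by a unitary preserves the trace, so both sides are normalized by the same scalar.\<close>

lemma finite_paths [simp]: "finite J \<Longrightarrow> finite (paths J :: (nat \<Rightarrow> 'm::finite) set)"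
  unfolding paths_def by (rule finite_PiE) auto

text \<open>Pinning coordinate \<open>k + 1\<close> leaves coordinate \<open>k\<close> free, which
  is why \<open>x_k\<close> is summed in \<open>C_{k+1}\<close> just as in
  \<open>D_k\<close>.\<close>

lemma sum_paths_to_Suc:
  "(\<Sum>x\<in>paths_to (k + 1) a. g x) = (\<Sum>x\<in>paths {1..k}. g (x(k + 1 := a)))"
  by (rule sum.reindex_bij_witness[where i = "\<lambda>x. x(k + 1 := a)" and j = "\<lambda>x. restrict x {1..k}"])
     (auto simp: paths_to_def paths_def PiE_iff extensional_def fun_eq_iff intro!: arg_cong[where f = g])

lemma sum_paths_by_endpoint:
  fixes g :: "(nat \<Rightarrow> 'm::finite) \<Rightarrow> 'a::comm_monoid_add"
  shows "(\<Sum>x\<in>paths {1..k}. g x) = (\<Sum>b\<in>UNIV. \<Sum>x\<in>paths_to k b. g x)"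
  unfolding paths_to_def by (rule sum.group[symmetric]) auto

text \<open>On each class of path pairs with common endpoints the factor \<open>u\<close> is
  constant and can be pulled out.\<close>

lemma sum_path_pairs_by_endpoints:
  fixes g :: "(nat \<Rightarrow> 'm::finite) \<Rightarrow> (nat \<Rightarrow> 'm) \<Rightarrow> 'a::comm_semiring_0"
  shows "(\<Sum>x\<in>paths {1..k}. \<Sum>x'\<in>paths {1..k}. g x x' * u (x k) (x' k)) =
    (\<Sum>b\<in>UNIV. \<Sum>b'\<in>UNIV. (\<Sum>x\<in>paths_to k b. \<Sum>x'\<in>paths_to k b'. g x x') * u b b')"
proof -
  have "(\<Sum>x\<in>paths {1..k}. \<Sum>x'\<in>paths {1..k}. g x x' * u (x k) (x' k)) =
      (\<Sum>b\<in>UNIV. \<Sum>x\<in>paths_to k b. \<Sum>b'\<in>UNIV. \<Sum>x'\<in>paths_to k b'. g x x' * u (x k) (x' k))"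
    by (simp only: sum_paths_by_endpoint)
  also have "\<dots> = (\<Sum>b\<in>UNIV. \<Sum>x\<in>paths_to k b. \<Sum>b'\<in>UNIV. \<Sum>x'\<in>paths_to k b'. g x x' * u b b')"
    by (intro sum.cong refl) (simp add: paths_to_def)
  also have "\<dots> = (\<Sum>b\<in>UNIV. \<Sum>b'\<in>UNIV. \<Sum>x\<in>paths_to k b. \<Sum>x'\<in>paths_to k b'. g x x' * u b b')"
    by (intro sum.cong refl) (rule sum.swap)
  finally show ?thesis
    by (simp add: sum_distrib_right)
qed

text \<open>Only the new factor \<open>j = k\<close> reads coordinate \<open>k + 1\<close>; since
  \<open>1 \<le> k\<close>, the initial \<open>U 0\<close> factor reads coordinate 1 and is
  untouched by the update.\<close>

lemma path_weight_extend:
  assumes "1 \<le> k"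
  shows "path_weight p U f y (k + 1) x0 (x(k + 1 := a)) (x'(k + 1 := a')) xt xt' =
    path_weight p U f y k x0 x x' xt xt' * f k (x k) (x' k) (xt k) (xt' k) (y k) *
    (U k $ a $ xt k) * cnj (U k $ a' $ xt' k)"
proof -
  have "{1..<k + 1} = insert k {1..<k}"
    using assms by auto
  moreover have "(\<Prod>j\<in>{1..<k}. f j ((x(k + 1 := a)) j) ((x'(k + 1 := a')) j) (xt j) (xt' j) (y j) *
        (U j $ (x(k + 1 := a)) (j + 1) $ xt j) * cnj (U j $ (x'(k + 1 := a')) (j + 1) $ xt' j)) =
      (\<Prod>j\<in>{1..<k}. f j (x j) (x' j) (xt j) (xt' j) (y j) *
        (U j $ x (j + 1) $ xt j) * cnj (U j $ x' (j + 1) $ xt' j))"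
    by (rule prod.cong) auto
  ultimately show ?thesis
    using assms by (simp add: path_weight_def mult_ac)
qed

lemma conjugate_entry:
  "(A ** D ** hermitian_transpose A) $ a $ a' =
     (\<Sum>b\<in>UNIV. \<Sum>b'\<in>UNIV. D $ b $ b' * (A $ a $ b) * cnj (A $ a' $ b'))"
  by (subst sum.swap)
     (simp add: matrix_matrix_mult_def hermitian_transpose_def
        sum_distrib_left sum_distrib_right mult_ac)

lemma pre_matrix_Suc:
  assumes "1 \<le> k"
  shows "pre_matrix p U f y (k + 1) =
    U k ** post_matrix p U f y k ** hermitian_transpose (U k)"
proof -
  \<comment> \<open>The tilde paths of \<open>C_{k+1}\<close> stop at index \<open>k\<close>,
    exactly where those of \<open>D_k\<close> end.\<close>
  have interval: "{1..<k + 1} = {1..k}"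
    by auto
  have "pre_matrix p U f y (k + 1) $ a $ a' =
      (U k ** post_matrix p U f y k ** hermitian_transpose (U k)) $ a $ a'" for a a'
  proof -
    let ?w = "\<lambda>x0 x x' xt xt'. path_weight p U f y k x0 x x' xt xt' *
      f k (x k) (x' k) (xt k) (xt' k) (y k)"
    let ?u = "\<lambda>b b'. (U k $ a $ b) * cnj (U k $ a' $ b')"
    have "pre_matrix p U f y (k + 1) $ a $ a' =
        (\<Sum>x0\<in>UNIV. \<Sum>x\<in>paths {1..k}. \<Sum>x'\<in>paths {1..k}. \<Sum>xt\<in>paths {1..k}. \<Sum>xt'\<in>paths {1..k}.
           ?w x0 x x' xt xt' * ?u (xt k) (xt' k))"
      unfolding pre_matrix_def vec_lambda_beta interval sum_paths_to_Suc
      by (intro sum.cong refl) (simp only: path_weight_extend[OF assms] mult.assoc)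
    also have "\<dots> = (\<Sum>x0\<in>UNIV. \<Sum>x\<in>paths {1..k}. \<Sum>x'\<in>paths {1..k}. \<Sum>b\<in>UNIV. \<Sum>b'\<in>UNIV.
        (\<Sum>xt\<in>paths_to k b. \<Sum>xt'\<in>paths_to k b'. ?w x0 x x' xt xt') * ?u b b')"
      by (intro sum.cong refl) (rule sum_path_pairs_by_endpoints)
    also have "\<dots> = (\<Sum>b\<in>UNIV. \<Sum>b'\<in>UNIV. \<Sum>x0\<in>UNIV. \<Sum>x\<in>paths {1..k}. \<Sum>x'\<in>paths {1..k}.
        (\<Sum>xt\<in>paths_to k b. \<Sum>xt'\<in>paths_to k b'. ?w x0 x x' xt xt') * ?u b b')"
      \<comment> \<open>Instantiating \<open>sum.swap\<close> orients it: path sums only move inward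
        past the sums over \<open>b\<close> and \<open>b'\<close>. The sum over \<open>x0\<close>
        also ranges over \<open>UNIV\<close>, so it is moved by hand.\<close>
      by (simp only: sum.swap[where A = "paths {1..k}" and B = UNIV])
         (rule trans[OF sum.swap], rule sum.cong[OF refl], rule sum.swap)
    also have "\<dots> = (\<Sum>b\<in>UNIV. \<Sum>b'\<in>UNIV. post_matrix p U f y k $ b $ b' * ?u b b')"
      by (simp add: post_matrix_def sum_distrib_right)
    finally show ?thesis
      by (simp add: conjugate_entry mult.assoc)
  qed
  then show ?thesis
    by (simp add: vec_eq_iff)
qed

text \<open>Cyclicity of the trace brings \<open>hermitian_transpose A\<close> next to
  \<open>A\<close>, where they cancel.\<close>

lemma trace_unitary_conjugate:
  assumes "unitary_matrix A"
  shows "trace (A ** D ** hermitian_transpose A) = trace D"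
  using assms
  by (simp add: unitary_matrix_def trace_mul_sym[of "A ** D"] matrix_mul_assoc)

lemma normalize_trace_conjugate:
  assumes "unitary_matrix A"
  shows "normalize_trace (A ** D ** hermitian_transpose A) =
    A ** normalize_trace D ** hermitian_transpose A"
  by (simp add: vec_eq_iff normalize_trace_def trace_unitary_conjugate[OF assms]
        conjugate_entry sum_divide_distrib)

theorem proposition3:
  fixes n k :: nat
    and p :: "'m::finite pmf"
    and U :: "nat \<Rightarrow> complex ^ 'm ^ 'm"
    and Y :: "nat \<Rightarrow> ('m + 'y) set"
    and f :: "nat \<Rightarrow> ('m, 'm + 'y) factor"
    and y :: "nat \<Rightarrow> 'm + 'y"
  assumes "n \<ge> 1"
    and "\<And>j. j < n \<Longrightarrow> unitary_matrix (U j)"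
    and "\<And>j. 1 \<le> j \<Longrightarrow> j \<le> n \<Longrightarrow> measurement_factor (Y j) (f j)"
    and "1 \<le> k" and "k \<le> n - 1"
    and "\<And>j. 1 \<le> j \<Longrightarrow> j \<le> k \<Longrightarrow> y j \<in> Y j"
    and "trace (post_matrix p U f y k) \<noteq> 0"
    and "trace (pre_matrix p U f y (k + 1)) \<noteq> 0"
  shows "pre_density p U f y (k + 1) =
           U k ** post_density p U f y k ** hermitian_transpose (U k)"
proof -
  \<comment> \<open>From \<open>1 \<le> k\<close> and \<open>k \<le> n - 1\<close> it follows that
    \<open>k < n\<close>, the range in which the \<open>U j\<close> are unitary.\<close>
  have "unitary_matrix (U k)"
    using assms by simp
  then show ?thesis
    using \<open>1 \<le> k\<close>
    by (simp only: pre_density_def post_density_def pre_matrix_Suc normalize_trace_conjugate)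
qed

end
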